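(* Let $E$ be an algebra over $k$ and let $\theta_\times=(\theta,\varepsilon)$ be a twisting system of $E\times E$. Then the vector space $E\times E$ with the multiplication determined by $$\varepsilon_jx\star\varepsilon_{j'}x'=\sum_{s,t=1}^2\varepsilon_tl_{t;js}\theta_{sj'}(x)x',\qquad x,x'\in E,\ j,j'\in\{1,2\},$$ is an (associative unital) algebra.
   Context: $k$ is an algebraically closed field of characteristic $0$. An invertible basis of $k\times k$ is a $k$-basis $\varepsilon=\{\varepsilon_1=(a_1,a_2),\varepsilon_2=(b_1,b_2)\}$ with $a_1a_2b_1b_2\ne0$. The scalars $l_{p;jj'}\in k$ are defined by $\varepsilon_j\varepsilon_{j'}=\sum_{p=1}^2\varepsilon_pl_{p;jj'}$ (product in $k\times k$). For $x\in E$, $(a,b)x=(ax,bx)\in E\times E$, so $E\times E=\varepsilon_1E\oplus\varepsilon_2E$. A linear map $\theta=(\theta_{jj'}):E\to M_2(E)$ is $t$-invertible if there is a linear map $\varphi=(\varphi_{jj'}):E\to M_2(E)$ with $\sum_{r=1}^2\varphi_{ri}\theta_{rj}=\delta_{ij}\mathrm{id}_E$ and $\sum_{r=1}^2\theta_{jr}\varphi_{ir}=\delta_{ij}\mathrm{id}_E$ for $i,j=1,2$ (products are compositions). A twisting system of $E\times E$ is a pair $\theta_\times=(\theta,\varepsilon)$ with $\varepsilon$ an invertible basis of $k\times k$ and $\theta:E\to M_2(E)$ a $t$-invertible linear map such that $\theta(1)\in GL_2(k)$ and, for all $x,x'\in E$ and $j,j',p\in\{1,2\}$, $\sum_{s,u=1}^2l_{p;su}\theta_{uj'}(\theta_{sj}(x)x')=\sum_{t,u=1}^2l_{t;ju}\theta_{pt}(x)\theta_{uj'}(x')$.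 The resulting algebra is called the twisted direct product of $E\times E$ and denoted ${}^{\theta_\times}(E\times E)$. *)

theory Defs
  imports "HOL-Analysis.Analysis" "HOL-Computational_Algebra.Computational_Algebra"
begin

text \<open>
  Associative unital algebras over a field, with explicit multiplication and unit. The unit is
  allowed to be zero, so the zero algebra is included.
\<close>

locale unital_algebra = vector_space smul
  for smul :: "'k::field \<Rightarrow> 'a::ab_group_add \<Rightarrow> 'a" +
  fixes mult :: "'a \<Rightarrow> 'a \<Rightarrow> 'a" and unit :: 'a
  assumes mult_linear_right: "Vector_Spaces.linear smul smul (\<lambda>y. mult x y)"
    and mult_linear_left: "Vector_Spaces.linear smul smul (\<lambda>x. mult x y)"
    and mult_assoc: "mult (mult x y) z = mult x (mult y z)"
    and mult_unit_left: "mult unit x = x"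
    and mult_unit_right: "mult x unit = x"

abbreviation pair_scale :: "('k::field \<Rightarrow> 'a::ab_group_add \<Rightarrow> 'a) \<Rightarrow> 'k \<Rightarrow> 'a \<times> 'a \<Rightarrow> 'a \<times> 'a"
  where "pair_scale smul \<equiv> module_prod.scale smul smul"

definition pair_times :: "'k::field \<times> 'k \<Rightarrow> 'k \<times> 'k \<Rightarrow> 'k \<times> 'k"
  where "pair_times a b = (fst a * fst b, snd a * snd b)"

definition pair_act :: "('k::field \<Rightarrow> 'e::ab_group_add \<Rightarrow> 'e) \<Rightarrow> 'k \<times> 'k \<Rightarrow> 'e \<Rightarrow> 'e \<times> 'e"
  where "pair_act smul a x = (smul (fst a) x, smul (snd a) x)"

definition mat_scale :: "('k::field \<Rightarrow> 'e::ab_group_add \<Rightarrow> 'e) \<Rightarrow> 'k \<Rightarrow> 'e^2^2 \<Rightarrow> 'e^2^2"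
  where "mat_scale smul c M = (\<chi> i j. smul c (M $ i $ j))"

text \<open>
  Indices \<open>1, 2\<close> are the two elements of the numeral type \<open>2\<close> (in which \<open>2 = 0\<close>). Injectivity is
  needed because \<^const>\<open>module.dependent\<close> only sees the underlying set of the family.
\<close>

definition invertible_basis :: "('k::field \<times> 'k)^2 \<Rightarrow> bool"
  where "invertible_basis \<epsilon> \<longleftrightarrow>
    inj (($) \<epsilon>) \<and>
    \<not> module.dependent (pair_scale (*)) (range (($) \<epsilon>)) \<and>
    module.span (pair_scale (*)) (range (($) \<epsilon>)) = UNIV \<and>
    fst (\<epsilon> $ 1) * snd (\<epsilon> $ 1) * fst (\<epsilon> $ 2) * snd (\<epsilon> $ 2) \<noteq> 0"

text \<open>\<open>structure_const \<epsilon> p j j'\<close> is the scalar $l_{p;jj'}$.\<close>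

definition structure_const :: "('k::field \<times> 'k)^2 \<Rightarrow> 2 \<Rightarrow> 2 \<Rightarrow> 2 \<Rightarrow> 'k"
  where "structure_const \<epsilon> p j j' =
    module.representation (pair_scale (*)) (range (($) \<epsilon>)) (pair_times (\<epsilon> $ j) (\<epsilon> $ j')) (\<epsilon> $ p)"

lemma structure_const:
  fixes \<epsilon> :: "('k::field \<times> 'k)^2"
  assumes "invertible_basis \<epsilon>"
  shows "pair_times (\<epsilon> $ j) (\<epsilon> $ j') =
    (\<Sum>p\<in>UNIV. pair_scale (*) (structure_const \<epsilon> p j j') (\<epsilon> $ p))"
proof -
  interpret vp: vector_space_prod "(*) :: 'k \<Rightarrow> 'k \<Rightarrow> 'k" "(*) :: 'k \<Rightarrow> 'k \<Rightarrow> 'k"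
    by unfold_locales (simp_all add: algebra_simps)
  let ?B = "range (($) \<epsilon>)" and ?v = "pair_times (\<epsilon> $ j) (\<epsilon> $ j')"
  have inj: "inj (($) \<epsilon>)" and "\<not> vp.p.dependent ?B" "?v \<in> vp.p.span ?B"
    using assms by (simp_all add: invertible_basis_def)
  then have "(\<Sum>b\<in>?B. pair_scale (*) (vp.p.representation ?B ?v b) b) = ?v"
    by (intro vp.p.sum_representation_eq) auto
  then show ?thesis
    by (simp add: sum.reindex[OF inj] structure_const_def)
qed

definition t_invertible :: "('k::field \<Rightarrow> 'e::ab_group_add \<Rightarrow> 'e) \<Rightarrow> ('e \<Rightarrow> 'e^2^2) \<Rightarrow> bool"
  where "t_invertible smul \<theta> \<longleftrightarrow>
    (\<exists>\<phi>. Vector_Spaces.linear smul (mat_scale smul) \<phi> \<and>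
      (\<forall>i j x. (\<Sum>r\<in>UNIV. \<phi> (\<theta> x $ r $ j) $ r $ i) = (if i = j then x else 0)) \<and>
      (\<forall>i j x. (\<Sum>r\<in>UNIV. \<theta> (\<phi> x $ i $ r) $ j $ r) = (if i = j then x else 0)))"

text \<open>
  The condition \<open>\<theta>(1) \<in> GL\<^sub>2(k)\<close> means that \<open>\<theta>(1)\<close> is the image of an invertible scalar matrix
  under \<open>k \<rightarrow> E\<close>, \<open>c \<mapsto> c 1\<close>.
\<close>

definition twisting_system ::
    "('k::field \<Rightarrow> 'e::{ring,monoid_mult} \<Rightarrow> 'e) \<Rightarrow> ('e \<Rightarrow> 'e^2^2) \<Rightarrow> ('k \<times> 'k)^2 \<Rightarrow> bool"
  where "twisting_system smul \<theta> \<epsilon> \<longleftrightarrow>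
    invertible_basis \<epsilon> \<and>
    Vector_Spaces.linear smul (mat_scale smul) \<theta> \<and>
    t_invertible smul \<theta> \<and>
    (\<exists>A :: 'k^2^2. invertible A \<and> \<theta> 1 = (\<chi> i j. smul (A $ i $ j) 1)) \<and>
    (\<forall>x x' j j' p.
      (\<Sum>s\<in>UNIV. \<Sum>u\<in>UNIV.
        smul (structure_const \<epsilon> p s u) (\<theta> (\<theta> x $ s $ j * x') $ u $ j')) =
      (\<Sum>t\<in>UNIV. \<Sum>u\<in>UNIV.
        smul (structure_const \<epsilon> t j u) (\<theta> x $ p $ t * \<theta> x' $ u $ j')))"

text \<open>
  \<open>m\<close> is a multiplication on \<open>E \<times> E\<close> given by the twisted formula on the elements \<open>\<epsilon>\<^sub>j x\<close> and
  extended by distributivity. Since \<open>E \<times> E = \<epsilon>\<^sub>1 E \<oplus> \<epsilon>\<^sub>2 E\<close>, biadditivity is enough to determine \<open>m\<close>.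
\<close>

definition twisted_mult ::
    "('k::field \<Rightarrow> 'e::{ring,monoid_mult} \<Rightarrow> 'e) \<Rightarrow> ('e \<Rightarrow> 'e^2^2) \<Rightarrow> ('k \<times> 'k)^2 \<Rightarrow>
      ('e \<times> 'e \<Rightarrow> 'e \<times> 'e \<Rightarrow> 'e \<times> 'e) \<Rightarrow> bool"
  where "twisted_mult smul \<theta> \<epsilon> m \<longleftrightarrow>
    (\<forall>u. Modules.additive (\<lambda>v. m u v)) \<and>
    (\<forall>v. Modules.additive (\<lambda>u. m u v)) \<and>
    (\<forall>x x' j j'.
      m (pair_act smul (\<epsilon> $ j) x) (pair_act smul (\<epsilon> $ j') x') =
      (\<Sum>s\<in>UNIV. \<Sum>t\<in>UNIV.
        pair_act smul (\<epsilon> $ t) (smul (structure_const \<epsilon> t j s) (\<theta> x $ s $ j' * x'))))"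

end

theory Submission
  imports Defs
begin

text \<open>
  Put \<open>\<tau>(x \<otimes> \<epsilon>\<^sub>j) = \<Sum>\<^sub>s \<epsilon>\<^sub>s \<otimes> \<theta>\<^sub>s\<^sub>j(x)\<close>. The product on \<open>E \<times> E = (k \<times> k) \<otimes> E\<close> multiplies \<open>k \<times> k\<close> from the left
  and \<open>E\<close> from the right onto \<open>\<tau>\<close>, and the twisting identity is what associativity requires of \<open>\<tau>\<close>.
  The unit need not be \<open>1 \<otimes> 1\<close>: if \<open>\<tau>(1 \<otimes> a) = \<alpha>(a) \<otimes> 1\<close>, it is \<open>d \<otimes> 1\<close> with \<open>\<alpha>(d) = 1\<close>. The twisting
  identity with \<open>x = 1\<close> and \<open>t\<close>-invertibility give \<open>\<alpha>(a b) = \<alpha>(a) b\<close>, which makes \<open>d \<otimes> 1\<close> a left unit; the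
  identity with \<open>x' = 1\<close> shows that \<open>d \<otimes> 1\<close> acts trivially from the right on the image of \<open>\<tau>\<close>, which is
  everything by \<open>t\<close>-invertibility.
\<close>

section \<open>Arithmetic of \<open>k \<times> k\<close> and coordinates in an invertible
  basis\<close>

lemma pair_scale_times: "pair_scale (*) c (a :: 'k::field \<times> 'k) = (c * fst a, c * snd a)"
proof -
  interpret vp: vector_space_prod "(*) :: 'k \<Rightarrow> 'k \<Rightarrow> 'k" "(*) :: 'k \<Rightarrow> 'k \<Rightarrow> 'k"
    by unfold_locales (simp_all add: algebra_simps)
  show ?thesis by (simp add: vp.scale_def)
qed

lemma pair_times_assoc: "pair_times (pair_times a b) c = pair_times a (pair_times b c)"
  by (simp add: pair_times_def)

lemma pair_times_commute: "pair_times a b = pair_times b a"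
  by (simp add: pair_times_def mult.commute)

lemma pair_times_one_right: "pair_times a (1, 1) = a"
  by (simp add: pair_times_def)

lemma pair_times_sum_left: "pair_times (\<Sum>i\<in>S. f i) b = (\<Sum>i\<in>S. pair_times (f i) b)"
  by (simp add: pair_times_def prod_eq_iff fst_sum snd_sum sum_distrib_right)

lemma pair_times_sum_right: "pair_times a (\<Sum>i\<in>S. f i) = (\<Sum>i\<in>S. pair_times a (f i))"
  by (simp add: pair_times_def prod_eq_iff fst_sum snd_sum sum_distrib_left)

lemma pair_times_scale_left: "pair_times (pair_scale (*) c a) b = pair_scale (*) c (pair_times a b)"
  by (simp add: pair_times_def pair_scale_times mult.assoc)

lemma pair_times_scale_right: "pair_times a (pair_scale (*) c b) = pair_scale (*) c (pair_times a b)"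
  by (simp add: pair_times_def pair_scale_times mult_ac)

text \<open>Extends \<open>structure_const\<close>, which gives coordinates of products of basis
  vectors only. The arguments \<open>(1, 1)\<close>, \<open>(1, 0)\<close> and \<open>(0, 1)\<close>
  are needed as well: the first for the unit, the others for projecting \<open>E \<times> E\<close>
  onto its summands.\<close>

definition basis_coord :: "('k::field \<times> 'k)^2 \<Rightarrow> 'k \<times> 'k \<Rightarrow> 2 \<Rightarrow> 'k"
  where "basis_coord \<epsilon> a j =
    module.representation (pair_scale (*)) (range (($) \<epsilon>)) a (\<epsilon> $ j)"

lemma structure_const_eq_coord:
  "structure_const \<epsilon> p j j' = basis_coord \<epsilon> (pair_times (\<epsilon> $ j) (\<epsilon> $ j')) p"
  by (simp add: structure_const_def basis_coord_def)

lemma structure_const_commute: "structure_const \<epsilon> p i j = structure_const \<epsilon> p j i"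
  by (simp add: structure_const_eq_coord pair_times_commute)

context
  fixes \<epsilon> :: "('k::field \<times> 'k)^2"
  assumes basis: "invertible_basis \<epsilon>"
begin

interpretation vp: vector_space_prod "(*) :: 'k \<Rightarrow> 'k \<Rightarrow> 'k" "(*) :: 'k \<Rightarrow> 'k \<Rightarrow> 'k"
  by unfold_locales (simp_all add: algebra_simps)

lemma invertible_basis_facts:
  "inj (($) \<epsilon>)" "vp.p.independent (range (($) \<epsilon>))" "a \<in> vp.p.span (range (($) \<epsilon>))"
  using basis by (simp_all add: invertible_basis_def)

lemma sum_basis_coord: "(\<Sum>j\<in>UNIV. pair_scale (*) (basis_coord \<epsilon> a j) (\<epsilon> $ j)) = a"
proof -
  have "(\<Sum>b\<in>range (($) \<epsilon>). pair_scale (*) (vp.p.representation (range (($) \<epsilon>)) a b) b) = a"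
    using invertible_basis_facts by (intro vp.p.sum_representation_eq) auto
  then show ?thesis
    by (simp add: sum.reindex[OF invertible_basis_facts(1)] basis_coord_def)
qed

lemma basis_coord_add: "basis_coord \<epsilon> (a + b) j = basis_coord \<epsilon> a j + basis_coord \<epsilon> b j"
  unfolding basis_coord_def
  by (subst vp.p.representation_add) (use invertible_basis_facts in auto)

lemma basis_coord_scale: "basis_coord \<epsilon> (pair_scale (*) c a) j = c * basis_coord \<epsilon> a j"
  unfolding basis_coord_def
  by (subst vp.p.representation_scale) (use invertible_basis_facts in auto)

lemma basis_coord_basis: "basis_coord \<epsilon> (\<epsilon> $ i) j = (if i = j then 1 else 0)"
  unfolding basis_coord_def
  using invertible_basis_facts
  by (subst vp.p.representation_basis) (auto simp: inj_def)

lemma basis_coord_sum: "basis_coord \<epsilon> (\<Sum>i\<in>S. f i) j = (\<Sum>i\<in>S. basis_coord \<epsilon> (f i) j)"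
  unfolding basis_coord_def
  by (subst vp.p.representation_sum) (use invertible_basis_facts in auto)

text \<open>Expand \<open>(1, 1)\<close> in the basis inside the product of
  \<open>\<epsilon> $ j\<close> with \<open>(1, 1)\<close> and compare coefficients of
  \<open>\<epsilon> $ t\<close>.\<close>

lemma sum_structure_const_unit:
  "(\<Sum>u\<in>UNIV. structure_const \<epsilon> t j u * basis_coord \<epsilon> (1, 1) u) = (if j = t then 1 else 0)"
proof -
  have "basis_coord \<epsilon> (\<epsilon> $ j) t =
      basis_coord \<epsilon> (pair_times (\<epsilon> $ j)
        (\<Sum>u\<in>UNIV. pair_scale (*) (basis_coord \<epsilon> (1, 1) u) (\<epsilon> $ u))) t"
    by (simp only: sum_basis_coord pair_times_one_right)
  also have "\<dots> = (\<Sum>u\<in>UNIV. structure_const \<epsilon> t j u * basis_coord \<epsilon> (1, 1) u)"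
    by (simp add: pair_times_sum_right pair_times_scale_right basis_coord_sum basis_coord_scale
        structure_const_eq_coord mult.commute)
  finally show ?thesis by (simp add: basis_coord_basis)
qed

end

section \<open>The decomposition of \<open>E \<times> E\<close> along the basis\<close>

locale twisted_product = unital_algebra smul "(*)" 1
  for smul :: "'k::field \<Rightarrow> 'e::{ring,monoid_mult} \<Rightarrow> 'e" +
  fixes \<theta> :: "'e \<Rightarrow> 'e^2^2"
    and \<epsilon> :: "('k \<times> 'k)^2"
  assumes twisting: "twisting_system smul \<theta> \<epsilon>"
begin

abbreviation "l \<equiv> structure_const \<epsilon>"
abbreviation "P \<equiv> pair_act smul"
abbreviation "coord \<equiv> basis_coord \<epsilon>"

lemma invertible_basis: "invertible_basis \<epsilon>"
  using twisting by (simp add: twisting_system_def)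

lemmas sum_coord = sum_basis_coord[OF invertible_basis]

lemma mult_smul_right: "x * smul c y = smul c (x * y)"
  using mult_linear_right[of x] by (simp add: Vector_Spaces.linear_iff)

lemma mult_smul_left: "smul c x * y = smul c (x * y)"
  using mult_linear_left[of y] by (simp add: Vector_Spaces.linear_iff)

lemma theta_add: "\<theta> (x + y) $ i $ j = \<theta> x $ i $ j + \<theta> y $ i $ j"
  using twisting by (simp add: twisting_system_def Vector_Spaces.linear_iff)

lemma theta_smul: "\<theta> (smul c x) $ i $ j = smul c (\<theta> x $ i $ j)"
  using twisting by (simp add: twisting_system_def Vector_Spaces.linear_iff mat_scale_def)

lemma twist:
  "(\<Sum>s\<in>UNIV. \<Sum>u\<in>UNIV. smul (l p s u) (\<theta> (\<theta> x $ s $ j * x') $ u $ j')) =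
    (\<Sum>t\<in>UNIV. \<Sum>u\<in>UNIV. smul (l t j u) (\<theta> x $ p $ t * \<theta> x' $ u $ j'))"
  using twisting unfolding twisting_system_def by blast

lemma pair_scale_smul: "pair_scale smul c v = (smul c (fst v), smul c (snd v))"
proof -
  interpret vp: vector_space_prod smul smul by unfold_locales
  show ?thesis by (simp add: vp.scale_def)
qed

lemma pair_act_zero: "P a 0 = 0"
  by (simp add: pair_act_def zero_prod_def)

lemma pair_act_add_right: "P a (x + y) = P a x + P a y"
  by (simp add: pair_act_def scale_right_distrib)

lemma pair_act_sum_left: "P (\<Sum>i\<in>S. f i) x = (\<Sum>i\<in>S. P (f i) x)"
  by (simp add: pair_act_def prod_eq_iff fst_sum snd_sum scale_sum_left)

lemma pair_act_sum_right: "P a (\<Sum>i\<in>S. f i) = (\<Sum>i\<in>S. P a (f i))"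
  by (simp add: pair_act_def prod_eq_iff fst_sum snd_sum scale_sum_right)

lemma pair_act_scale_left: "P (pair_scale (*) c a) x = P a (smul c x)"
  by (simp add: pair_act_def pair_scale_times mult.commute)

lemma pair_scale_pair_act: "pair_scale smul c (P a x) = P a (smul c x)"
  by (simp add: pair_act_def pair_scale_smul mult.commute)

lemma pair_act_expand: "P a x = (\<Sum>j\<in>UNIV. P (\<epsilon> $ j) (smul (coord a j) x))"
proof -
  have "P (\<Sum>j\<in>UNIV. pair_scale (*) (coord a j) (\<epsilon> $ j)) x =
      (\<Sum>j\<in>UNIV. P (\<epsilon> $ j) (smul (coord a j) x))"
    by (simp add: pair_act_sum_left pair_act_scale_left)
  then show ?thesis by (simp add: sum_coord)
qed

lemma pair_act_times_basis:
  "P (pair_times (\<epsilon> $ i) (\<epsilon> $ j)) x = (\<Sum>t\<in>UNIV. P (\<epsilon> $ t) (smul (l t i j) x))"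
  by (subst pair_act_expand) (simp add: structure_const_eq_coord)

lemma pair_act_times_expand_left:
  "P (pair_times a b) x = (\<Sum>i\<in>UNIV. P (pair_times (\<epsilon> $ i) b) (smul (coord a i) x))"
proof -
  have "P (pair_times (\<Sum>i\<in>UNIV. pair_scale (*) (coord a i) (\<epsilon> $ i)) b) x =
      (\<Sum>i\<in>UNIV. P (pair_times (\<epsilon> $ i) b) (smul (coord a i) x))"
    by (simp add: pair_times_sum_left pair_times_scale_left pair_act_sum_left pair_act_scale_left)
  then show ?thesis by (simp add: sum_coord)
qed

text \<open>The projection onto the \<open>j\<close>-th summand of
  \<open>\<epsilon>\<^sub>1 E \<oplus> \<epsilon>\<^sub>2 E\<close>, obtained by writing
  \<open>v\<close> as \<open>(1, 0)\<close> acting on \<open>fst v\<close> plus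
  \<open>(0, 1)\<close> acting on \<open>snd v\<close>.\<close>

definition component :: "2 \<Rightarrow> 'e \<times> 'e \<Rightarrow> 'e"
  where "component j v = smul (coord (1, 0) j) (fst v) + smul (coord (0, 1) j) (snd v)"

lemma sum_component: "(\<Sum>j\<in>UNIV. P (\<epsilon> $ j) (component j v)) = v"
proof -
  have "(\<Sum>j\<in>UNIV. P (\<epsilon> $ j) (component j v)) = P (1, 0) (fst v) + P (0, 1) (snd v)"
    unfolding component_def pair_act_add_right sum.distrib pair_act_expand[symmetric] ..
  then show ?thesis by (simp add: pair_act_def)
qed

lemma component_add: "component j (u + v) = component j u + component j v"
  by (simp add: component_def scale_right_distrib)

lemma component_pair_act: "component j (P a x) = smul (coord a j) x"
proof -
  have "a = pair_scale (*) (fst a) (1, 0) + pair_scale (*) (snd a) (0, 1)"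
    by (simp add: pair_scale_times)
  then have "coord a j = fst a * coord (1, 0) j + snd a * coord (0, 1) j"
    by (metis basis_coord_add[OF invertible_basis] basis_coord_scale[OF invertible_basis])
  then show ?thesis
    by (simp add: component_def pair_act_def scale_left_distrib mult.commute)
qed

lemma component_basis: "component i (P (\<epsilon> $ j) x) = (if j = i then x else 0)"
  by (simp add: component_pair_act basis_coord_basis[OF invertible_basis])

text \<open>By \<open>sum_component\<close>, every \<open>v\<close> is a sum of two generators
  \<open>P (\<epsilon> $ j) x\<close>. Identities additive in each argument thus reduce to
  generators.\<close>

lemma pair_act_induct:
  assumes "\<And>j x. Q (P (\<epsilon> $ j) x)" and "\<And>u v. Q u \<Longrightarrow> Q v \<Longrightarrow> Q (u + v)"
  shows "Q v"
proof -
  have "Q (P (\<epsilon> $ 1) (component 1 v) + P (\<epsilon> $ 2) (component 2 v))"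
    by (intro assms)
  then show ?thesis using sum_component[of v] by (simp add: sum_2)
qed

section \<open>Existence, uniqueness and bilinearity of the multiplication\<close>

text \<open>The prescribed formula, extended through the components. Its sum over \<open>t\<close>
  is absorbed into the product of \<open>\<epsilon> $ j\<close> and
  \<open>\<epsilon> $ s\<close>.\<close>

definition twisted_times :: "'e \<times> 'e \<Rightarrow> 'e \<times> 'e \<Rightarrow> 'e \<times> 'e"
  where "twisted_times u v = (\<Sum>j\<in>UNIV. \<Sum>j'\<in>UNIV. \<Sum>s\<in>UNIV.
    P (pair_times (\<epsilon> $ j) (\<epsilon> $ s)) (\<theta> (component j u) $ s $ j' * component j' v))"

lemma theta_zero: "\<theta> 0 $ i $ j = 0"
  using theta_smul[of 0 0] by simp

lemma twisted_mult_twisted_times: "twisted_mult smul \<theta> \<epsilon> twisted_times"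
  unfolding twisted_mult_def
proof (intro conjI allI)
  show "Modules.additive (twisted_times u)" for u
    by unfold_locales
      (simp add: twisted_times_def component_add distrib_left pair_act_add_right sum.distrib)
  show "Modules.additive (\<lambda>u. twisted_times u v)" for v
    by unfold_locales
      (simp add: twisted_times_def component_add theta_add distrib_right pair_act_add_right sum.distrib)
  show "twisted_times (P (\<epsilon> $ i) x) (P (\<epsilon> $ i') x') =
      (\<Sum>s\<in>UNIV. \<Sum>t\<in>UNIV. P (\<epsilon> $ t) (smul (l t i s) (\<theta> x $ s $ i' * x')))" for i i' x x'
  proof -
    \<comment> \<open>A generator has one nonzero component, so only \<open>j = i\<close> and
      \<open>j' = i'\<close> survive.\<close>
    have "(\<Sum>s\<in>UNIV. P (pair_times (\<epsilon> $ j) (\<epsilon> $ s))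
          (\<theta> (if i = j then x else 0) $ s $ j' * (if i' = j' then x' else 0))) =
        (if i' = j' then if i = j then \<Sum>s\<in>UNIV.
          P (pair_times (\<epsilon> $ j) (\<epsilon> $ s)) (\<theta> x $ s $ j' * x') else 0 else 0)" for j j'
      by (simp add: theta_zero pair_act_zero)
    then show ?thesis
      by (simp add: twisted_times_def component_basis pair_act_times_basis)
  qed
qed

lemma twisted_mult_add:
  assumes "twisted_mult smul \<theta> \<epsilon> m"
  shows "m u (v + w) = m u v + m u w" "m (u + v) w = m u w + m v w"
  using assms unfolding twisted_mult_def Modules.additive_def by - blast+

lemma twisted_mult_sum:
  assumes "twisted_mult smul \<theta> \<epsilon> m"
  shows "m u (\<Sum>i\<in>S. f i) = (\<Sum>i\<in>S. m u (f i))" "m (\<Sum>i\<in>S. f i) u = (\<Sum>i\<in>S. m (f i) u)"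
  using assms additive.sum[of "m u" f S] additive.sum[of "\<lambda>v. m v u" f S]
  unfolding twisted_mult_def by - blast+

lemma twisted_mult_basis:
  assumes "twisted_mult smul \<theta> \<epsilon> m"
  shows "m (P (\<epsilon> $ i) y) (P (\<epsilon> $ j) x) =
    (\<Sum>u\<in>UNIV. P (pair_times (\<epsilon> $ i) (\<epsilon> $ u)) (\<theta> y $ u $ j * x))"
  using assms by (simp add: twisted_mult_def pair_act_times_basis)

lemma twisted_mult_unique:
  assumes m: "twisted_mult smul \<theta> \<epsilon> m" and m': "twisted_mult smul \<theta> \<epsilon> m'"
  shows "m = m'"
proof (intro ext)
  fix u v
  show "m u v = m' u v"
  proof (induction u rule: pair_act_induct)
    case (1 i y)
    show ?case
      by (induction v rule: pair_act_induct)
        (simp_all add: twisted_mult_basis m m' twisted_mult_add[OF m] twisted_mult_add[OF m'])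
  qed (simp add: twisted_mult_add[OF m] twisted_mult_add[OF m'])
qed

text \<open>The product is linear over \<open>k \<times> k\<close> on the left: scalars pass through
  \<open>\<theta>\<close>, so \<open>a\<close> may be expanded in the basis and reassembled.
  Iterated products need this for \<open>a\<close> a product of basis vectors.\<close>

lemma twisted_mult_pair_act:
  assumes m: "twisted_mult smul \<theta> \<epsilon> m"
  shows "m (P a y) (P (\<epsilon> $ j) x) =
    (\<Sum>u\<in>UNIV. P (pair_times a (\<epsilon> $ u)) (\<theta> y $ u $ j * x))"
proof -
  have "m (P a y) (P (\<epsilon> $ j) x) = (\<Sum>i\<in>UNIV. m (P (\<epsilon> $ i) (smul (coord a i) y)) (P (\<epsilon> $ j) x))"
    by (subst pair_act_expand) (simp add: twisted_mult_sum[OF m])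
  also have "\<dots> = (\<Sum>i\<in>UNIV. \<Sum>u\<in>UNIV.
      P (pair_times (\<epsilon> $ i) (\<epsilon> $ u)) (smul (coord a i) (\<theta> y $ u $ j * x)))"
    by (simp add: twisted_mult_basis[OF m] theta_smul mult_smul_left)
  also have "\<dots> = (\<Sum>u\<in>UNIV. P (pair_times a (\<epsilon> $ u)) (\<theta> y $ u $ j * x))"
    by (subst sum.swap) (simp add: pair_act_times_expand_left[of a])
  finally show ?thesis .
qed

text \<open>On generators, scalars pass through \<open>\<theta>\<close> and through the product of
  \<open>E\<close>; biadditivity extends this to all of \<open>E \<times> E\<close>.\<close>

lemma twisted_mult_scale:
  assumes m: "twisted_mult smul \<theta> \<epsilon> m"
  shows "m u (pair_scale smul c v) = pair_scale smul c (m u v)"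
    and "m (pair_scale smul c u) v = pair_scale smul c (m u v)"
proof -
  interpret vp: vector_space_prod smul smul by unfold_locales
  note simps = pair_scale_pair_act twisted_mult_basis[OF m] vp.p.scale_sum_right mult_smul_left
    mult_smul_right theta_smul twisted_mult_add[OF m] vp.p.scale_right_distrib
  show "m u (pair_scale smul c v) = pair_scale smul c (m u v)"
  proof (induction u rule: pair_act_induct)
    case (1 i y)
    show ?case by (induction v rule: pair_act_induct) (simp_all add: simps)
  qed (simp add: simps)
  show "m (pair_scale smul c u) v = pair_scale smul c (m u v)"
  proof (induction u rule: pair_act_induct)
    case (1 i y)
    show ?case by (induction v rule: pair_act_induct) (simp_all add: simps)
  qed (simp add: simps)
qed

section \<open>Associativity\<close>

text \<open>Collects terms so that the coefficient at each \<open>\<epsilon> $ p\<close> takes the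
  shape of the left side of \<open>twist\<close>.\<close>

lemma sum_pair_act_times_basis:
  "(\<Sum>s\<in>UNIV. \<Sum>u\<in>UNIV. P (pair_times a (pair_times (\<epsilon> $ s) (\<epsilon> $ u))) (f s u)) =
    (\<Sum>p\<in>UNIV. P (pair_times a (\<epsilon> $ p)) (\<Sum>s\<in>UNIV. \<Sum>u\<in>UNIV. smul (l p s u) (f s u)))"
proof -
  have "P (pair_times a (pair_times (\<epsilon> $ s) (\<epsilon> $ u))) y =
      (\<Sum>p\<in>UNIV. P (pair_times a (\<epsilon> $ p)) (smul (l p s u) y))" for s u y
    by (subst (1) structure_const[OF invertible_basis])
      (simp add: pair_times_sum_right pair_times_scale_right pair_act_sum_left pair_act_scale_left)
  then show ?thesis
    by (simp add: sum_2 pair_act_add_right)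
qed

text \<open>Collected along the products of \<open>\<epsilon> $ i\<close> and
  \<open>\<epsilon> $ p\<close>, the two bracketings have as coefficients the two sides of
  \<open>twist\<close>, multiplied by \<open>z\<close> on the right.\<close>

lemma twisted_mult_assoc_basis:
  assumes m: "twisted_mult smul \<theta> \<epsilon> m"
  shows "m (m (P (\<epsilon> $ i) x) (P (\<epsilon> $ j) y)) (P (\<epsilon> $ k) z) =
    m (P (\<epsilon> $ i) x) (m (P (\<epsilon> $ j) y) (P (\<epsilon> $ k) z))"
proof -
  have "m (m (P (\<epsilon> $ i) x) (P (\<epsilon> $ j) y)) (P (\<epsilon> $ k) z) =
      (\<Sum>s\<in>UNIV. \<Sum>u\<in>UNIV. P (pair_times (\<epsilon> $ i) (pair_times (\<epsilon> $ s) (\<epsilon> $ u)))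
        (\<theta> (\<theta> x $ s $ j * y) $ u $ k * z))"
    by (simp add: twisted_mult_basis[OF m] twisted_mult_sum[OF m] twisted_mult_pair_act[OF m]
        pair_times_assoc)
  also have "\<dots> = (\<Sum>p\<in>UNIV. P (pair_times (\<epsilon> $ i) (\<epsilon> $ p))
      ((\<Sum>s\<in>UNIV. \<Sum>u\<in>UNIV. smul (l p s u) (\<theta> (\<theta> x $ s $ j * y) $ u $ k)) * z))"
    by (simp add: sum_pair_act_times_basis sum_distrib_right mult_smul_left)
  also have "\<dots> = (\<Sum>p\<in>UNIV. P (pair_times (\<epsilon> $ i) (\<epsilon> $ p))
      (\<Sum>u\<in>UNIV. \<Sum>t\<in>UNIV. \<theta> x $ p $ t * smul (l t j u) (\<theta> y $ u $ k * z)))"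
    unfolding twist
    by (subst sum.swap) (simp add: sum_distrib_right mult_smul_left mult_smul_right mult.assoc)
  also have "\<dots> = (\<Sum>u\<in>UNIV. \<Sum>t\<in>UNIV. \<Sum>p\<in>UNIV. P (pair_times (\<epsilon> $ i) (\<epsilon> $ p))
      (\<theta> x $ p $ t * smul (l t j u) (\<theta> y $ u $ k * z)))"
    by (simp add: sum_2 pair_act_add_right)
  also have "\<dots> = m (P (\<epsilon> $ i) x) (m (P (\<epsilon> $ j) y) (P (\<epsilon> $ k) z))"
    by (simp add: twisted_mult_basis[OF m] twisted_mult_sum[OF m] pair_act_times_basis[of j])
  finally show ?thesis .
qed

lemma twisted_mult_assoc:
  assumes m: "twisted_mult smul \<theta> \<epsilon> m"
  shows "m (m u v) w = m u (m v w)"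
proof (induction u rule: pair_act_induct)
  case (1 i x)
  show ?case
  proof (induction v rule: pair_act_induct)
    case (1 j y)
    show ?case
      by (induction w rule: pair_act_induct)
        (simp_all add: twisted_mult_assoc_basis[OF m] twisted_mult_add[OF m])
  qed (simp add: twisted_mult_add[OF m])
qed (simp add: twisted_mult_add[OF m])

section \<open>The unit\<close>

text \<open>The \<open>d j\<close> are the coordinates of the element that \<open>\<alpha>\<close>
  sends to \<open>(1, 1)\<close>; they solve a linear system with invertible matrix
  \<open>A\<close>.\<close>

lemma theta_one_unit:
  obtains A :: "'k^2^2" and d :: "2 \<Rightarrow> 'k" where "\<theta> 1 = (\<chi> i j. smul (A $ i $ j) 1)"
    and "\<And>s. (\<Sum>j\<in>UNIV. A $ s $ j * d j) = coord (1, 1) s"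
proof -
  obtain A :: "'k^2^2" where A: "invertible A" "\<theta> 1 = (\<chi> i j. smul (A $ i $ j) 1)"
    using twisting by (auto simp: twisting_system_def)
  then obtain B :: "'k^2^2" where B: "A ** B = mat 1"
    by (auto simp: invertible_def)
  define d where "d = B *v (\<chi> s. coord (1, 1) s)"
  have "A *v d = (\<chi> s. coord (1, 1) s)"
    by (simp add: d_def matrix_vector_mul_assoc B)
  then have "(\<Sum>j\<in>UNIV. A $ s $ j * d $ j) = coord (1, 1) s" for s
    by (simp add: vec_eq_iff matrix_vector_mult_def)
  with A(2) show thesis by (rule that)
qed

text \<open>
  Writing \<open>\<alpha>(\<epsilon>\<^sub>j) = \<Sum>\<^sub>s A\<^sub>s\<^sub>j \<epsilon>\<^sub>s\<close>, this says \<open>\<alpha>(\<epsilon>\<^sub>j) \<epsilon>\<^sub>i = \<alpha>(\<epsilon>\<^sub>j \<epsilon>\<^sub>i)\<close>, as operators on \<open>E\<close>. It is the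
  twisting identity at \<open>1, \<phi>\<^sub>i\<^sub>j\<^sub>'(x)\<close>, summed over \<open>j'\<close>.
\<close>

lemma theta_one_structure_const:
  fixes A :: "'k^2^2"
  assumes A: "\<theta> 1 = (\<chi> i j. smul (A $ i $ j) 1)"
  shows "(\<Sum>s\<in>UNIV. smul (l p s i * A $ s $ j) x) = (\<Sum>t\<in>UNIV. smul (l t j i * A $ p $ t) x)"
proof -
  obtain \<phi> where \<phi>: "\<And>i j x. (\<Sum>r\<in>UNIV. \<theta> (\<phi> x $ i $ r) $ j $ r) = (if i = j then x else 0)"
    using twisting unfolding twisting_system_def t_invertible_def by blast
  \<comment> \<open>Solved for the summand at \<open>1\<close>, the identity becomes a rewrite rule;
    the summands at \<open>2\<close> then cancel in the sums over \<open>j'\<close>.\<close>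
  have \<phi>: "\<theta> (\<phi> x $ i $ 1) $ j $ 1 = (if i = j then x else 0) - \<theta> (\<phi> x $ i $ 2) $ j $ 2"
    for i j x using \<phi>[of x i j] by (simp add: sum_2 eq_diff_eq)
  have "(\<Sum>j'\<in>UNIV. \<Sum>s\<in>UNIV. \<Sum>u\<in>UNIV. smul (l p s u) (\<theta> (\<theta> 1 $ s $ j * \<phi> x $ i $ j') $ u $ j')) =
      (\<Sum>j'\<in>UNIV. \<Sum>t\<in>UNIV. \<Sum>u\<in>UNIV. smul (l t j u) (\<theta> 1 $ p $ t * \<theta> (\<phi> x $ i $ j') $ u $ j'))"
    by (simp only: twist)
  then show ?thesis
    using exhaust_2[of i]
    by (auto simp: A sum_2 mult_smul_left theta_smul \<phi> scale_right_diff_distrib algebra_simps)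
qed

text \<open>Both sides are the action on \<open>x\<close> of
  \<open>\<alpha>(\<epsilon>\<^sub>i \<epsilon>\<^sub>j)\<close>, which is symmetric because
  \<open>k \<times> k\<close> is commutative.\<close>

lemma pair_act_theta_one_commute:
  fixes A :: "'k^2^2"
  assumes A: "\<theta> 1 = (\<chi> i j. smul (A $ i $ j) 1)"
  shows "(\<Sum>s\<in>UNIV. P (pair_times (\<epsilon> $ i) (\<epsilon> $ s)) (smul (A $ s $ j) x)) =
    (\<Sum>s\<in>UNIV. P (pair_times (\<epsilon> $ j) (\<epsilon> $ s)) (smul (A $ s $ i) x))"
proof -
  have *: "(\<Sum>s\<in>UNIV. P (pair_times (\<epsilon> $ i) (\<epsilon> $ s)) (smul (A $ s $ j) x)) =
      (\<Sum>p\<in>UNIV. P (\<epsilon> $ p) (\<Sum>t\<in>UNIV. smul (l t j i * A $ p $ t) x))" for i j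
    unfolding theta_one_structure_const[OF A, symmetric] pair_act_times_basis
    by (subst sum.swap) (simp add: pair_act_sum_right structure_const_commute[of _ _ i])
  show ?thesis by (simp only: * structure_const_commute[of _ _ i j])
qed

lemma twisted_mult_unit:
  assumes m: "twisted_mult smul \<theta> \<epsilon> m"
  obtains e where "\<And>v. m e v = v" "\<And>v. m v e = v"
proof -
  obtain A :: "'k^2^2" and d :: "2 \<Rightarrow> 'k" where A: "\<theta> 1 = (\<chi> i j. smul (A $ i $ j) 1)"
    and d: "\<And>s. (\<Sum>j\<in>UNIV. A $ s $ j * d j) = coord (1, 1) s"
    using theta_one_unit by blast
  define e where "e = (\<Sum>i\<in>UNIV. P (\<epsilon> $ i) (smul (d i) 1))"
  have left: "m e v = v" for v
  proof (induction v rule: pair_act_induct)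
    case (1 j x)
    have "m e (P (\<epsilon> $ j) x) =
        (\<Sum>i\<in>UNIV. \<Sum>s\<in>UNIV. P (pair_times (\<epsilon> $ i) (\<epsilon> $ s)) (smul (A $ s $ j) (smul (d i) x)))"
      by (simp add: e_def twisted_mult_sum[OF m] twisted_mult_basis[OF m] theta_smul A
          mult_smul_left mult.commute)
    also have "\<dots> = (\<Sum>s\<in>UNIV. P (pair_times (\<epsilon> $ j) (\<epsilon> $ s)) (smul (coord (1, 1) s) x))"
      \<comment> \<open>Exchanging \<open>i\<close> and \<open>j\<close> puts the summation index
        \<open>i\<close> on \<open>A\<close> alone, so that the sum over \<open>i\<close> is the
        system solved by \<open>d\<close>.\<close>
      unfolding pair_act_theta_one_commute[OF A, of _ j]
      by (subst sum.swap) (simp add: pair_act_sum_right[symmetric] scale_sum_left d[symmetric])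
    also have "\<dots> = P (pair_times (1, 1) (\<epsilon> $ j)) x"
      unfolding pair_act_times_expand_left[of "(1, 1)"] by (simp add: pair_times_commute)
    also have "\<dots> = P (\<epsilon> $ j) x"
      by (simp add: pair_times_commute[of "(1, 1)"] pair_times_one_right)
    finally show ?case .
  qed (simp add: twisted_mult_add[OF m])
  have right_theta: "m (\<Sum>p\<in>UNIV. P (\<epsilon> $ p) (\<theta> y $ p $ j)) e = (\<Sum>p\<in>UNIV. P (\<epsilon> $ p) (\<theta> y $ p $ j))"
    for y j
  proof -
    \<comment> \<open>The factors \<open>(1, 1)\<close> and \<open>* 1\<close> are inserted to match
      \<open>sum_pair_act_times_basis\<close> and \<open>twist\<close> with
      \<open>x' = 1\<close>.\<close>
    have "m (\<Sum>p\<in>UNIV. P (\<epsilon> $ p) (\<theta> y $ p $ j)) e =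
        (\<Sum>i\<in>UNIV. \<Sum>s\<in>UNIV. \<Sum>u\<in>UNIV. P (pair_times (1, 1) (pair_times (\<epsilon> $ s) (\<epsilon> $ u)))
          (smul (d i) (\<theta> (\<theta> y $ s $ j * 1) $ u $ i)))"
      by (simp add: e_def twisted_mult_sum[OF m] twisted_mult_basis[OF m] mult_smul_right
          pair_times_commute[of "(1, 1)"] pair_times_one_right)
    also have "\<dots> = (\<Sum>i\<in>UNIV. \<Sum>p\<in>UNIV. P (\<epsilon> $ p)
        (smul (d i) (\<Sum>s\<in>UNIV. \<Sum>u\<in>UNIV. smul (l p s u) (\<theta> (\<theta> y $ s $ j * 1) $ u $ i))))"
      unfolding sum_pair_act_times_basis
      by (simp add: pair_times_commute[of "(1, 1)"] pair_times_one_right scale_sum_right mult.commute)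
    also have "\<dots> = (\<Sum>p\<in>UNIV. P (\<epsilon> $ p)
        (\<Sum>t\<in>UNIV. smul (\<Sum>u\<in>UNIV. l t j u * (\<Sum>i\<in>UNIV. A $ u $ i * d i)) (\<theta> y $ p $ t)))"
      unfolding twist
      by (simp add: A mult_smul_right sum_2 pair_act_add_right[symmetric] algebra_simps)
    also have "\<dots> = (\<Sum>p\<in>UNIV. P (\<epsilon> $ p) (\<Sum>t\<in>UNIV. if j = t then \<theta> y $ p $ t else 0))"
      unfolding d sum_structure_const_unit[OF invertible_basis]
      by (intro sum.cong arg_cong[where f = "P _"]) auto
    finally show ?thesis by simp
  qed
  have right: "m v e = v" for v
  proof (induction v rule: pair_act_induct)
    case (1 i x)
    obtain \<phi> where \<phi>: "\<And>i j x. (\<Sum>r\<in>UNIV. \<theta> (\<phi> x $ i $ r) $ j $ r) = (if i = j then x else 0)"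
      using twisting unfolding twisting_system_def t_invertible_def by blast
    \<comment> \<open>The second identity of \<open>t\<close>-invertibility writes the generator as
      the sum over \<open>r\<close> of \<open>\<tau>(\<phi>\<^sub>i\<^sub>r(x) \<otimes>
      \<epsilon>\<^sub>r)\<close>, to which \<open>right_theta\<close> applies.\<close>
    have "(\<Sum>r\<in>UNIV. \<Sum>p\<in>UNIV. P (\<epsilon> $ p) (\<theta> (\<phi> x $ i $ r) $ p $ r)) =
        (\<Sum>p\<in>UNIV. P (\<epsilon> $ p) (if i = p then x else 0))"
      by (subst sum.swap) (simp add: pair_act_sum_right[symmetric] \<phi>)
    also have "\<dots> = (\<Sum>p\<in>UNIV. if i = p then P (\<epsilon> $ p) x else 0)"
      by (intro sum.cong) (auto simp: pair_act_zero)
    finally have span: "P (\<epsilon> $ i) x = (\<Sum>r\<in>UNIV. \<Sum>p\<in>UNIV. P (\<epsilon> $ p) (\<theta> (\<phi> x $ i $ r) $ p $ r))"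
      by simp
    show ?case
      unfolding span by (subst twisted_mult_sum[OF m]) (simp only: right_theta)
  qed (simp add: twisted_mult_add[OF m])
  show thesis using left right by (rule that)
qed

lemma unital_algebra_twisted_mult:
  assumes m: "twisted_mult smul \<theta> \<epsilon> m"
  shows "\<exists>e. unital_algebra (pair_scale smul) m e"
proof -
  interpret vp: vector_space_prod smul smul by unfold_locales
  obtain e where e: "\<And>v. m e v = v" "\<And>v. m v e = v"
    using twisted_mult_unit[OF m] by blast
  have "unital_algebra (pair_scale smul) m e"
    by unfold_locales
      (simp_all add: e twisted_mult_assoc[OF m] twisted_mult_add[OF m] twisted_mult_scale[OF m]
        vp.p.scale_right_distrib vp.p.scale_left_distrib)
  then show ?thesis ..
qed

end

theorem corollary2p14:
  fixes smul :: "'k::{alg_closed_field,field_char_0} \<Rightarrow> 'e::{ring,monoid_mult} \<Rightarrow> 'e"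
    and \<theta> :: "'e \<Rightarrow> 'e^2^2"
    and \<epsilon> :: "('k \<times> 'k)^2"
  assumes "unital_algebra smul (*) 1"
    and "twisting_system smul \<theta> \<epsilon>"
  shows "(\<exists>!m. twisted_mult smul \<theta> \<epsilon> m) \<and>
    (\<forall>m. twisted_mult smul \<theta> \<epsilon> m \<longrightarrow> (\<exists>e. unital_algebra (pair_scale smul) m e))"
proof -
  interpret twisted_product smul \<theta> \<epsilon>
    using assms by (simp add: twisted_product_def twisted_product_axioms_def)
  show ?thesis
    using twisted_mult_twisted_times twisted_mult_unique unital_algebra_twisted_mult by blast
qed

end
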